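(* For every integer $q\ge 2$, \[ K(2,q)=P_q-\sum_{i=0}^{q-2}z^{q-2-i}\cdot K(2,i), \] where \[ P_q=\ell D^{q-1}+\sum_{i=1}^{q-1} d\,L^{i}D^{q-1-i} \] is specialized via $L=a=\ell^{-1}$ and $D=d=z$.
   Context: **The polynomial $K$.** $K$ assigns to each unoriented link diagram an element of $\mathbb{Z}[a^{\pm1},z^{\pm1}]$, is invariant under planar isotopy and Reidemeister moves II and III, and satisfies: $K(L_+)+K(L_-)=z\,(K(L_a)+K(L_b))$, where $L_+,L_-,L_a,L_b$ are identical outside a disk in which they are respectively a crossing, the opposite crossing, and its two smoothings; $K(L_{pos})=a^{-1}K(L)$ when $L_{pos}$ is obtained from $L$ by adding a positive kink (Reidemeister I curl with positive crossing) and $K(L_{neg})=aK(L)$ for a negative kink; $K(O)=1$ for the crossingless unknot diagram $O$; $K(L\sqcup O)=\left(\frac{a+a^{-1}}{z}-1\right)K(L)$. (The Kauffman polynomial is obtained from $K$ by multiplying by a power of $a$ depending on the writhe.) **Notation.** $K(2,q)$ is the value of $K$ on the standard diagram of the $(2,q)$ torus link, i.e. the closure of the $2$-braid $\sigma_1^q$, $q\ge 0$, where $\sigma_1$ is a positive crossing when both strands are oriented in the same direction. Thus $K(2,0)=\frac{a+a^{-1}}{z}-1$ and $K(2,1)=a^{-1}$. The polynomial $P_q$ in the letters $L,\ell,D,d$ is the sum of the activity words of the perfect matchings of the balanced overlaid Tait graph of the $(2,q)$ torus knot, which is given by the displayed formula. *)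

theory Defs
  imports "HOL-Library.Poly_Mapping" "HOL-Library.Product_Plus"
begin

section \<open>The ring of Laurent polynomials in two variables\<close>

text \<open>
  The Laurent polynomial ring \<open>\<int>[a\<^sup>\<plusminus>\<^sup>1, z\<^sup>\<plusminus>\<^sup>1]\<close> is the group ring over the integers of the additive
  group of exponent pairs: \<open>(i, j)\<close> stands for the monomial \<open>a\<^sup>i z\<^sup>j\<close>, and the multiplication of
  \<^type>\<open>poly_mapping\<close> is convolution.
\<close>

type_synonym laurent = "(int \<times> int) \<Rightarrow>\<^sub>0 int"

definition var_a :: laurent where "var_a = Poly_Mapping.single (1, 0) 1"
definition inv_a :: laurent where "inv_a = Poly_Mapping.single (-1, 0) 1"
definition var_z :: laurent where "var_z = Poly_Mapping.single (0, 1) 1"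
definition inv_z :: laurent where "inv_z = Poly_Mapping.single (0, -1) 1"

lemma var_a_inv_a: "var_a * inv_a = 1"
  by (simp add: var_a_def inv_a_def mult_single flip: single_one zero_prod_def)

lemma var_z_inv_z: "var_z * inv_z = 1"
  by (simp add: var_z_def inv_z_def mult_single flip: single_one zero_prod_def)


section \<open>Unoriented link diagrams\<close>

text \<open>
  A link diagram in the plane is given in Morse position with respect to the height function, as the
  list of its critical points and crossings, read from bottom to top. The entry \<open>(g, i)\<close> is
  the elementary piece \<open>g\<close> with exactly \<open>i\<close> vertical strands to its left; strands are counted
  from \<open>0\<close>. \<open>Cup\<close> is a local minimum, \<open>Cap\<close> a local maximum. In \<open>Over\<close> the strand running from
  bottom left to top right is the upper one, in \<open>Under\<close> it is the lower one.
  If both strands are oriented upwards (or both downwards), \<open>Over\<close> is a positive crossing and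
  \<open>Under\<close> a negative one.
\<close>

datatype piece = Cup | Cap | Over | Under

type_synonym diagram = "(piece \<times> nat) list"

fun ins :: "piece \<Rightarrow> nat" where
  "ins Cup = 0" | "ins Cap = 2" | "ins Over = 2" | "ins Under = 2"

fun outs :: "piece \<Rightarrow> nat" where
  "outs Cup = 2" | "outs Cap = 0" | "outs Over = 2" | "outs Under = 2"

text \<open>\<open>tangle m D n\<close>: \<open>D\<close> is a tangle diagram with \<open>m\<close> lower and \<open>n\<close> upper end points.\<close>

fun tangle :: "nat \<Rightarrow> diagram \<Rightarrow> nat \<Rightarrow> bool" where
  "tangle m [] n \<longleftrightarrow> m = n"
| "tangle m ((g, i) # D) n \<longleftrightarrow> i + ins g \<le> m \<and> tangle (m - ins g + outs g) D n"

text \<open>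
  The empty diagram has to be excluded: \<open>K(O) = 1\<close> and the rule for \<open>L \<squnion> O\<close> would
  otherwise force \<open>(a + a\<^sup>-\<^sup>1)/z - 1\<close> to be a unit.
\<close>

definition link_diagram :: "diagram \<Rightarrow> bool" where
  "link_diagram D \<longleftrightarrow> D \<noteq> [] \<and> tangle 0 D 0"

text \<open>
  A local move \<open>R X Y\<close> replaces the piece \<open>X\<close> of a link diagram by \<open>Y\<close>, the rest staying the same.
\<close>

definition in_diagram :: "(diagram \<Rightarrow> diagram \<Rightarrow> bool) \<Rightarrow> diagram \<Rightarrow> diagram \<Rightarrow> bool" where
  "in_diagram R D E \<longleftrightarrow> link_diagram D \<and> link_diagram E \<and>
     (\<exists>U X Y V. R X Y \<and> D = U @ X @ V \<and> E = U @ Y @ V)"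

text \<open>
  The moves generating planar isotopy of diagrams in Morse position: exchanging the heights of
  two pieces lying side by side (\<open>k\<close> is the number of strands between them), cancelling a minimum
  against an adjacent maximum, and turning a strand over at a crossing. In the last case the
  strand crossing the arc of the extremum stays above (or below) it, so that
  \<open>Over\<close> becomes \<open>Under\<close> and vice versa, because the crossing is rotated by a quarter turn.
\<close>

inductive planar_move :: "diagram \<Rightarrow> diagram \<Rightarrow> bool" where
  exchange: "planar_move [(g, i), (h, i + outs g + k)] [(h, i + ins g + k), (g, i)]"
| zigzag_left: "planar_move [(Cup, Suc i), (Cap, i)] []"
| zigzag_right: "planar_move [(Cup, i), (Cap, Suc i)] []"
| cap_over: "planar_move [(Over, Suc i), (Cap, i)] [(Under, i), (Cap, Suc i)]"
| cap_under: "planar_move [(Under, Suc i), (Cap, i)] [(Over, i), (Cap, Suc i)]"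
| cup_over: "planar_move [(Cup, i), (Over, Suc i)] [(Cup, Suc i), (Under, i)]"
| cup_under: "planar_move [(Cup, i), (Under, Suc i)] [(Cup, Suc i), (Over, i)]"

definition planar_isotopic :: "diagram \<Rightarrow> diagram \<Rightarrow> bool" where
  "planar_isotopic = equivclp (in_diagram planar_move)"

inductive reidemeister_II :: "diagram \<Rightarrow> diagram \<Rightarrow> bool" where
  "reidemeister_II [(Over, i), (Under, i)] []"
| "reidemeister_II [(Under, i), (Over, i)] []"

text \<open>
  The crossings \<open>x\<close>, \<open>y\<close>, \<open>w\<close> are those of strands 1 and 2, 1 and 3, 2 and 3. The last condition
  says that the three strands are linearly ordered by height, which fails only
  for the two cyclic configurations \<open>y \<noteq> x = w\<close>.
\<close>

inductive reidemeister_III :: "diagram \<Rightarrow> diagram \<Rightarrow> bool" where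
  "{x, y, w} \<subseteq> {Over, Under} \<Longrightarrow> y = x \<or> y = w \<Longrightarrow>
   reidemeister_III [(x, i), (y, Suc i), (w, i)] [(w, Suc i), (y, i), (x, Suc i)]"

text \<open>
  A kink on a vertical strand, lying to its right or to its left. Whichever way the strand is
  oriented, it passes the crossing twice in the same vertical direction, so that the sign of
  the kink is that of \<open>Over\<close> or \<open>Under\<close> as stated above. Kinks in any other position are planar
  isotopic to these.
\<close>

inductive add_kink :: "piece \<Rightarrow> diagram \<Rightarrow> diagram \<Rightarrow> bool" for x :: piece where
  right_kink: "add_kink x [] [(Cup, Suc i), (x, i), (Cap, Suc i)]"
| left_kink: "add_kink x [] [(Cup, i), (x, Suc i), (Cap, i)]"

abbreviation add_positive_kink :: "diagram \<Rightarrow> diagram \<Rightarrow> bool" where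
  "add_positive_kink \<equiv> add_kink Over"

abbreviation add_negative_kink :: "diagram \<Rightarrow> diagram \<Rightarrow> bool" where
  "add_negative_kink \<equiv> add_kink Under"

text \<open>The disjoint circle may be placed in any face of the diagram.\<close>

inductive add_circle :: "diagram \<Rightarrow> diagram \<Rightarrow> bool" where
  "add_circle [] [(Cup, i), (Cap, i)]"


section \<open>The polynomial \<open>K\<close>\<close>

definition unknot_diagram :: diagram where
  "unknot_diagram = [(Cup, 0), (Cap, 0)]"

definition delta :: laurent where
  "delta = (var_a + inv_a) * inv_z - 1"

locale kauffman_K =
  fixes K :: "diagram \<Rightarrow> laurent"
  assumes planar_isotopy: "planar_isotopic D E \<Longrightarrow> K D = K E"
    and move_II: "in_diagram reidemeister_II D E \<Longrightarrow> K D = K E"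
    and move_III: "in_diagram reidemeister_III D E \<Longrightarrow> K D = K E"
    and skein: "link_diagram (U @ [(Over, i)] @ V) \<Longrightarrow>
      K (U @ [(Over, i)] @ V) + K (U @ [(Under, i)] @ V) =
        var_z * (K (U @ V) + K (U @ [(Cap, i), (Cup, i)] @ V))"
    and positive_kink: "in_diagram add_positive_kink D E \<Longrightarrow> K E = inv_a * K D"
    and negative_kink: "in_diagram add_negative_kink D E \<Longrightarrow> K E = var_a * K D"
    and unknot: "K unknot_diagram = 1"
    and circle: "in_diagram add_circle D E \<Longrightarrow> K E = delta * K D"


section \<open>Torus links and the polynomial \<open>P\<close>\<close>

text \<open>The strands \<open>0, \<dots>, n - 1\<close> are joined to the strands \<open>2n - 1, \<dots>, n\<close> by nested arcs.\<close>

definition braid_closure :: "nat \<Rightarrow> diagram \<Rightarrow> diagram" where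
  "braid_closure n B =
     map (\<lambda>i. (Cup, i)) [0..<n] @ B @ map (\<lambda>i. (Cap, i)) (rev [0..<n])"

definition torus_link2 :: "nat \<Rightarrow> diagram" where
  "torus_link2 q = braid_closure 2 (replicate q (Over, 0))"

lemma link_diagram_torus_link2: "link_diagram (torus_link2 q)"
proof -
  have "tangle 4 (replicate q (Over, 0) @ [(Cap, 1), (Cap, 0)]) 0"
    by (induction q) auto
  then show ?thesis
    by (simp add: link_diagram_def torus_link2_def braid_closure_def upt_rec numeral_eq_Suc)
qed

text \<open>The polynomial \<open>P\<^sub>q\<close> in the letters \<open>L\<close>, \<open>l\<close> (for \<open>\<ell>\<close>), \<open>D\<close>, \<open>d\<close>, evaluated in a commutative ring.\<close>

definition P :: "nat \<Rightarrow> 'a::comm_ring_1 \<Rightarrow> 'a \<Rightarrow> 'a \<Rightarrow> 'a \<Rightarrow> 'a" where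
  "P q L l D d = l * D ^ (q - 1) + (\<Sum>i = 1..q - 1. d * L ^ i * D ^ (q - 1 - i))"

end

theory Submission
  imports Defs
begin

text \<open>
  Resolving the topmost crossing of \<open>\<sigma>\<^sub>1\<^sup>n\<^sup>+\<^sup>2\<close> by the skein relation gives
  \<open>K(2,n+2) + K(2,n) = z (K(2,n+1) + a\<^sup>n\<^sup>+\<^sup>1)\<close>.
  Switching the crossing leaves a Reidemeister II pair, hence \<open>\<sigma>\<^sub>1\<^sup>n\<close>; the vertical smoothing
  deletes the crossing; the horizontal smoothing closes the remaining \<open>n + 1\<close> crossings by an arc,
  and each of them is then a kink. Although these crossings are \<open>Over\<close>, the two strands
  joined by the arc pass them in opposite vertical directions, so that every kink is negative and
  contributes a factor \<open>a\<close> (lemma \<open>twist_below_cap\<close>); what is left is an unknot.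

  The polynomial \<open>P\<^sub>q\<close> and the sum on the right-hand side satisfy the first-order recurrences
  \<open>P\<^bsub>q+1\<^esub> = z P\<^sub>q + z a\<^sup>q\<close> and \<open>S\<^bsub>q+1\<^esub> = z S\<^sub>q + K(2,q-1)\<close>, whose difference is the recurrence above
  for \<open>K(2,q) = P\<^sub>q - S\<^sub>q\<close>. The induction can start at \<open>q = 1\<close>, where the sum is empty and
  \<open>K(2,1) = \<ell>\<close> is the value of a positive kink.
\<close>

lemma tangle_append: "tangle m (D @ E) n \<longleftrightarrow> (\<exists>k. tangle m D k \<and> tangle k E n)"
  by (induction m D n rule: tangle.induct) auto

text \<open>
  The invariance axioms require both sides to be link diagrams; this transports that property along a
  local replacement.
\<close>

lemma link_diagram_replace:
  assumes "link_diagram (U @ X @ V)"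
    and "\<And>m n. tangle m X n \<Longrightarrow> tangle m Y n"
    and "U @ Y @ V \<noteq> []"
  shows "link_diagram (U @ Y @ V)"
  using assms unfolding link_diagram_def tangle_append by blast

lemma replicate_Suc_snoc: "replicate (Suc n) x = replicate n x @ [x]"
  by (simp add: replicate_append_same)

lemma P_Suc:
  assumes "q \<ge> 1"
  shows "P (Suc q) L l D d = D * P q L l D d + d * L ^ q"
proof -
  obtain m where q: "q = Suc m"
    using assms by (cases q) auto
  have "(\<Sum>i = 1..m. d * L ^ i * D ^ (Suc m - i)) = D * (\<Sum>i = 1..m. d * L ^ i * D ^ (m - i))"
    unfolding sum_distrib_left by (intro sum.cong) (auto simp: Suc_diff_le algebra_simps)
  then show ?thesis
    by (simp add: P_def q algebra_simps)
qed

lemma torus_link2_eq: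
  "torus_link2 q = [(Cup, 0), (Cup, 1)] @ replicate q (Over, 0) @ [(Cap, 1), (Cap, 0)]"
  by (simp add: torus_link2_def braid_closure_def upt_rec numeral_eq_Suc)

context kauffman_K
begin

lemma planar_moveD:
  assumes "planar_move X Y" "link_diagram (U @ X @ V)" "link_diagram (U @ Y @ V)"
  shows "K (U @ X @ V) = K (U @ Y @ V)"
proof -
  have "in_diagram planar_move (U @ X @ V) (U @ Y @ V)"
    using assms unfolding in_diagram_def by blast
  then have "planar_isotopic (U @ X @ V) (U @ Y @ V)"
    unfolding planar_isotopic_def by (rule r_into_equivclp)
  then show ?thesis
    by (rule planar_isotopy)
qed

text \<open>
  A zigzag in the right strand below the crossing exhibits the twist as a kink. Once its maximum has
  been lifted above the crossing, its minimum can be slid across the left strand; this rotates the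
  crossing by a quarter turn and thus changes \<open>Over\<close> into \<open>Under\<close>, and the result is a negative
  kink on the left strand.
\<close>

lemma twist_below_cap:
  assumes link: "link_diagram (U @ [(Over, i), (Cap, i)] @ V)"
  shows "K (U @ [(Over, i), (Cap, i)] @ V) = var_a * K (U @ [(Cap, i)] @ V)"
proof -
  have ld: "link_diagram (U @ Y @ V)"
    if "\<And>m n. tangle m [(Over, i), (Cap, i)] n \<Longrightarrow> tangle m Y n" "Y \<noteq> []" for Y
    using link_diagram_replace[OF link that(1)] that(2) by blast
  have "K (U @ [(Over, i), (Cap, i)] @ V)
      = K (U @ [(Cup, Suc i), (Cap, Suc (Suc i)), (Over, i), (Cap, i)] @ V)"
    using planar_moveD[OF planar_move.zigzag_right[of "Suc i"], of U "[(Over, i), (Cap, i)] @ V"]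
      link ld[of "[(Cup, Suc i), (Cap, Suc (Suc i)), (Over, i), (Cap, i)]"]
    by simp
  also have "\<dots> = K (U @ [(Cup, Suc i), (Over, i), (Cap, Suc (Suc i)), (Cap, i)] @ V)"
    using planar_moveD[OF planar_move.exchange[of Over i Cap 0],
        of "U @ [(Cup, Suc i)]" "[(Cap, i)] @ V"]
      ld[of "[(Cup, Suc i), (Cap, Suc (Suc i)), (Over, i), (Cap, i)]"]
      ld[of "[(Cup, Suc i), (Over, i), (Cap, Suc (Suc i)), (Cap, i)]"]
    by simp
  also have "\<dots> = K (U @ [(Cup, Suc i), (Over, i), (Cap, i), (Cap, i)] @ V)"
    using planar_moveD[OF planar_move.exchange[of Cap i Cap 0],
        of "U @ [(Cup, Suc i), (Over, i)]" V]
      ld[of "[(Cup, Suc i), (Over, i), (Cap, Suc (Suc i)), (Cap, i)]"]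
      ld[of "[(Cup, Suc i), (Over, i), (Cap, i), (Cap, i)]"]
    by simp
  also have "\<dots> = K (U @ [(Cup, i), (Under, Suc i), (Cap, i), (Cap, i)] @ V)"
    using planar_moveD[OF planar_move.cup_under[of i], of U "[(Cap, i), (Cap, i)] @ V"]
      ld[of "[(Cup, Suc i), (Over, i), (Cap, i), (Cap, i)]"]
      ld[of "[(Cup, i), (Under, Suc i), (Cap, i), (Cap, i)]"]
    by simp
  also have "\<dots> = var_a * K (U @ [(Cap, i)] @ V)"
  proof (rule negative_kink, unfold in_diagram_def, intro conjI exI)
    show "link_diagram (U @ [(Cap, i)] @ V)"
      "link_diagram (U @ [(Cup, i), (Under, Suc i), (Cap, i), (Cap, i)] @ V)"
      by (rule ld; simp)+
    show "add_negative_kink [] [(Cup, i), (Under, Suc i), (Cap, i)]"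
      by (rule add_kink.left_kink)
    show "U @ [(Cap, i)] @ V = U @ [] @ ([(Cap, i)] @ V)"
      "U @ [(Cup, i), (Under, Suc i), (Cap, i), (Cap, i)] @ V
        = U @ [(Cup, i), (Under, Suc i), (Cap, i)] @ ([(Cap, i)] @ V)"
      by simp_all
  qed
  finally show ?thesis .
qed

text \<open>
  This is the horizontal smoothing of a torus link, after the minimum created by the smoothing has been
  cancelled: each of the \<open>n\<close> crossings lies below a maximum in turn.
\<close>

lemma K_twisted_unknot:
  "K ([(Cup, 0), (Cup, 1)] @ replicate n (Over, 0) @ [(Cap, 0), (Cap, 0)]) = var_a ^ n"
proof (induction n)
  case 0
  have "K ([(Cup, 0)] @ [(Cup, Suc 0), (Cap, 0)] @ [(Cap, 0)]) = K ([(Cup, 0)] @ [] @ [(Cap, 0)])"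
    by (rule planar_moveD[OF planar_move.zigzag_left]) (simp_all add: link_diagram_def)
  then show ?case
    using unknot by (simp add: unknot_diagram_def)
next
  case (Suc n)
  let ?U = "[(Cup, 0), (Cup, 1)] @ replicate n (Over, 0)"
  have "tangle 4 (replicate n (Over, 0) @ [(Over, 0), (Cap, 0), (Cap, 0)]) 0"
    by (induction n) auto
  then have "link_diagram (?U @ [(Over, 0), (Cap, 0)] @ [(Cap, 0)])"
    by (simp add: link_diagram_def numeral_eq_Suc)
  from twist_below_cap[OF this] Suc show ?case
    by (simp add: replicate_Suc_snoc del: replicate.simps)
qed

lemma K_torus_link2_1: "K (torus_link2 1) = inv_a"
proof -
  have "in_diagram add_positive_kink unknot_diagram (torus_link2 1)"
    unfolding in_diagram_def
  proof (intro conjI exI)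
    show "add_positive_kink [] [(Cup, Suc 0), (Over, 0), (Cap, Suc 0)]"
      by (rule add_kink.right_kink)
    show "unknot_diagram = [(Cup, 0)] @ [] @ [(Cap, 0)]"
      by (simp add: unknot_diagram_def)
    show "torus_link2 1 = [(Cup, 0)] @ [(Cup, Suc 0), (Over, 0), (Cap, Suc 0)] @ [(Cap, 0)]"
      by (simp add: torus_link2_eq)
  qed (simp_all add: link_diagram_torus_link2, simp add: unknot_diagram_def link_diagram_def)
  from positive_kink[OF this] show ?thesis
    by (simp add: unknot)
qed

lemma K_torus_link2_Suc_Suc:
  "K (torus_link2 (Suc (Suc n))) + K (torus_link2 n)
    = var_z * (K (torus_link2 (Suc n)) + var_a ^ Suc n)"
proof -
  define U :: diagram where "U = [(Cup, 0), (Cup, 1)] @ replicate (Suc n) (Over, 0)"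
  define V :: diagram where "V = [(Cap, 1), (Cap, 0)]"
  have crossing: "U @ [(Over, 0)] @ V = torus_link2 (Suc (Suc n))"
    by (simp add: torus_link2_eq U_def V_def replicate_Suc_snoc del: replicate.simps)
  have vertical: "U @ V = torus_link2 (Suc n)"
    by (simp add: torus_link2_eq U_def V_def)
  have link: "link_diagram (U @ [(Over, 0)] @ V)"
    unfolding crossing by (rule link_diagram_torus_link2)
  let ?W = "[(Cup, 0), (Cup, 1)] @ replicate n (Over, 0)"
  \<comment> \<open>The switched crossing cancels against the topmost crossing of \<open>U\<close>.\<close>
  have switched: "K (U @ [(Under, 0)] @ V) = K (torus_link2 n)"
  proof (rule move_II, unfold in_diagram_def, intro conjI exI)
    show "link_diagram (U @ [(Under, 0)] @ V)"
      by (rule link_diagram_replace[OF link]) auto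
    show "reidemeister_II [(Over, 0), (Under, 0)] []"
      by (rule reidemeister_II.intros)
    show "U @ [(Under, 0)] @ V = ?W @ [(Over, 0), (Under, 0)] @ V"
      unfolding U_def replicate_Suc_snoc by simp
    show "torus_link2 n = ?W @ [] @ V"
      by (simp add: torus_link2_eq V_def)
  qed (rule link_diagram_torus_link2)
  \<comment> \<open>The minimum of the horizontal smoothing forms a zigzag with the first maximum of \<open>V\<close>.\<close>
  have "K (U @ [(Cap, 0), (Cup, 0)] @ V) = var_a ^ Suc n"
  proof -
    have "link_diagram ((U @ [(Cap, 0)]) @ [(Cup, 0), (Cap, Suc 0)] @ [(Cap, 0)])"
      using link_diagram_replace[OF link, of "[(Cap, 0), (Cup, 0)]"] by (auto simp: V_def)
    moreover from this have "link_diagram ((U @ [(Cap, 0)]) @ [] @ [(Cap, 0)])"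
      by (rule link_diagram_replace) auto
    ultimately have "K ((U @ [(Cap, 0)]) @ [(Cup, 0), (Cap, Suc 0)] @ [(Cap, 0)])
        = K ((U @ [(Cap, 0)]) @ [] @ [(Cap, 0)])"
      by (rule planar_moveD[OF planar_move.zigzag_right])
    then show ?thesis
      using K_twisted_unknot[of "Suc n"] by (simp add: U_def V_def)
  qed
  with skein[OF link] switched show ?thesis
    unfolding crossing vertical by simp
qed

lemma K_torus_link2_Suc:
  "K (torus_link2 (Suc n)) = P (Suc n) var_a inv_a var_z var_z
    - (\<Sum>i<n. var_z ^ (n - 1 - i) * K (torus_link2 i))"
proof (induction n)
  case 0
  show ?case
    using K_torus_link2_1 by (simp add: P_def)
next
  case (Suc n)
  have "(\<Sum>i<n. var_z ^ (n - i) * K (torus_link2 i))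
      = var_z * (\<Sum>i<n. var_z ^ (n - 1 - i) * K (torus_link2 i))"
    unfolding sum_distrib_left
  proof (rule sum.cong)
    fix i assume "i \<in> {..<n}"
    then have "n - i = Suc (n - 1 - i)"
      by auto
    then show "var_z ^ (n - i) * K (torus_link2 i)
        = var_z * (var_z ^ (n - 1 - i) * K (torus_link2 i))"
      by (simp add: mult.assoc)
  qed simp
  moreover have "K (torus_link2 (Suc (Suc n)))
      = var_z * K (torus_link2 (Suc n)) + var_z * var_a ^ Suc n - K (torus_link2 n)"
    using K_torus_link2_Suc_Suc[of n] by (simp add: algebra_simps)
  ultimately show ?case
    unfolding Suc by (simp add: P_Suc algebra_simps)
qed

end

theorem proposition8p2:
  fixes K :: "diagram \<Rightarrow> laurent" and q :: nat
  assumes "kauffman_K K" and "q \<ge> 2"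
  shows "K (torus_link2 q) =
    P q var_a inv_a var_z var_z
      - (\<Sum>i = 0..q - 2. var_z ^ (q - 2 - i) * K (torus_link2 i))"
proof -
  interpret kauffman_K K by fact
  obtain n where q: "q = Suc (Suc n)"
    using assms(2) by (metis Suc_le_D numeral_2_eq_2 Suc_le_mono)
  have "{0..n} = {..<Suc n}"
    by auto
  then show ?thesis
    using K_torus_link2_Suc[of "Suc n"] by (simp add: q)
qed

end
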